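(* Let $k\ge 3$ and let $\alpha>0$ satisfy $\alpha<\alpha_{\mathrm{hc}}(k)$, where $\alpha_{\mathrm{hc}}(k)$ is the threshold clause density for the emergence of a hypercore. Then the probability that a random instance $H$ of $k$-QSAT on $N$ qubits at clause density $\alpha$ is satisfiable tends to $1$ as $N\to\infty$.
   Context: A random instance of $k$-QSAT on $N$ qubits at clause density $\alpha$ is generated as follows. Each of the $\binom{N}{k}$ possible $k$-element subsets of the $N$ qubits is included as an edge independently with probability $p=\alpha N/\binom{N}{k}$ (for $N$ large enough that $p\le 1$), giving a random hypergraph with edges $I_1,\dots,I_M$ and $\alpha N$ expected edges. Then for each edge $I_m$ a unit vector $|\phi_m\rangle$ in the $2^k$-dimensional Hilbert space of the $k$ qubits in $I_m$ is chosen, independently for different edges and uniformly (Haar measure) on the unit sphere. The instance is the operator $H=\sum_{m=1}^M\Pi^{I_m}_{\phi_m}$ on $(\mathbb{C}^2)^{\otimes N}$, where $\Pi^{I_m}_{\phi_m}$ is $|\phi_m\rangle\langle\phi_m|$ acting on the qubits in $I_m$, tensored with the identity on the remaining qubits. $H$ is satisfiable if $\ker(H)\ne\{0\}$. The hypercore of a hypergraph is the sub-hypergraph remaining after recursively stripping away leaf nodes, i.e. repeatedly removing any hyperedge that contains a node of degree $1$ (a node contained in exactly one remaining hyperedge), until no such hyperedge is left; it is empty if no hyperedges remain. The threshold $\alpha_{\mathrm{hc}}(k)$ is the supremum of the $\alpha>0$ such that the hypercore of the random hypergraph on $N$ nodes in which each of the $\binom{N}{k}$ possible $k$-element subsets of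 the nodes is included as an edge independently with probability $p=\alpha N/\binom{N}{k}$ is empty with probability tending to $1$ as $N\to\infty$. *)

theory Defs
  imports "HOL-Probability.Probability"
begin

section \<open>Random hypergraphs and the hypercore\<close>

text \<open>A hypergraph on the nodes \<open>0, \<dots>, N - 1\<close> is represented by its set of hyperedges.\<close>

definition ksubsets :: "nat \<Rightarrow> nat \<Rightarrow> nat set set" where
  "ksubsets k N = {I. I \<subseteq> {..<N} \<and> card I = k}"

text \<open>The parameter of \<^const>\<open>bernoulli_pmf\<close> is clamped to the unit interval. For \<open>k \<ge> 2\<close> this
  affects only finitely many \<open>N\<close>.\<close>

definition random_hypergraph :: "nat \<Rightarrow> real \<Rightarrow> nat \<Rightarrow> nat set set pmf" where
  "random_hypergraph k \<alpha> N =
     map_pmf (\<lambda>b. {I \<in> ksubsets k N. b I})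
       (Pi_pmf (ksubsets k N) False (\<lambda>_. bernoulli_pmf (\<alpha> * real N / real (N choose k))))"

definition node_degree :: "'v set set \<Rightarrow> 'v \<Rightarrow> nat" where
  "node_degree E v = card {e \<in> E. v \<in> e}"

inductive strip :: "'v set set \<Rightarrow> 'v set set \<Rightarrow> bool" where
  strip: "e \<in> E \<Longrightarrow> v \<in> e \<Longrightarrow> node_degree E v = 1 \<Longrightarrow> strip E (E - {e})"

definition hypercore :: "'v set set \<Rightarrow> 'v set set" where
  "hypercore E = (THE C. strip\<^sup>*\<^sup>* E C \<and> (\<nexists>D. strip C D))"

lemma strip_diamond:
  assumes "strip E A" "strip E B"
  shows "A = B \<or> (\<exists>C. strip A C \<and> strip B C)"
proof -
  obtain e v where e: "A = E - {e}" "e \<in> E" "v \<in> e" "node_degree E v = 1"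
    using assms(1) by (auto elim: strip.cases)
  obtain f w where f: "B = E - {f}" "f \<in> E" "w \<in> f" "node_degree E w = 1"
    using assms(2) by (auto elim: strip.cases)
  have other: "strip (E - {g}) (E - {g} - {h})"
    if h: "h \<in> E" "h \<noteq> g" "u \<in> h" "node_degree E u = 1" for g h u
  proof (rule strip.strip[OF _ h(3)])
    obtain x where x: "{d \<in> E. u \<in> d} = {x}"
      using h(4) unfolding node_degree_def by (auto simp: card_1_singleton_iff)
    then have "{d \<in> E - {g}. u \<in> d} = {h}" using h by auto
    then show "node_degree (E - {g}) u = 1" by (simp add: node_degree_def)
  qed (use h in auto)
  show ?thesis
  proof (cases "e = f")
    case False
    have "E - {e} - {f} = E - {f} - {e}" by auto
    then show ?thesis using other[of f e w] other[of e f v] e f False by metis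
  qed (use e f in auto)
qed

lemma hypercore_ex1:
  assumes "finite E"
  shows "\<exists>!C. strip\<^sup>*\<^sup>* E C \<and> (\<nexists>D. strip C D)"
  using assms
proof (induction "card E" arbitrary: E rule: less_induct)
  case less
  show ?case
  proof (cases "\<exists>A. strip E A")
    case False
    then show ?thesis by (metis converse_rtranclpE rtranclp.rtrancl_refl)
  next
    case True
    have smaller: "card A < card E \<and> finite A" if "strip E A" for A
      using that less.prems by (auto elim!: strip.cases intro!: psubset_card_mono)
    have ex1: "\<exists>!C. strip\<^sup>*\<^sup>* A C \<and> (\<nexists>D. strip C D)" if "strip E A" for A
      using less.hyps smaller[OF that] by blast
    have same: "C = D"
      if h: "strip E A" "strip\<^sup>*\<^sup>* A C" "\<nexists>X. strip C X" "strip E B" "strip\<^sup>*\<^sup>* B D" "\<nexists>X. strip D X"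
      for A B C D
    proof (cases "A = B")
      case False
      then obtain F where F: "strip A F" "strip B F" using strip_diamond[OF h(1,4)] by blast
      have "finite F" "card F < card E"
        using F(1) smaller[OF h(1)]
        by (auto elim!: strip.cases simp: card_Diff1_less intro: le_less_trans[OF card_Diff1_le])
      then obtain G where G: "strip\<^sup>*\<^sup>* F G" "\<nexists>X. strip G X" using less.hyps by blast
      have "strip\<^sup>*\<^sup>* A G" "strip\<^sup>*\<^sup>* B G" using F G(1) by (auto intro: converse_rtranclp_into_rtranclp)
      then show ?thesis using ex1[OF h(1)] ex1[OF h(4)] h G(2) by metis
    qed (use ex1 h in blast)
    obtain A where A: "strip E A" using True by blast
    obtain C where C: "strip\<^sup>*\<^sup>* A C" "\<nexists>X. strip C X" using ex1[OF A] by blast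
    show ?thesis
    proof (rule ex1I[of _ C])
      show "strip\<^sup>*\<^sup>* E C \<and> (\<nexists>D. strip C D)"
        using A C by (auto intro: converse_rtranclp_into_rtranclp)
      show "D = C" if "strip\<^sup>*\<^sup>* E D \<and> (\<nexists>X. strip D X)" for D
        using that A C same by (metis converse_rtranclpE)
    qed
  qed
qed

definition hypercore_threshold :: "nat \<Rightarrow> ereal" where
  "hypercore_threshold k =
     Sup (ereal ` {\<alpha>. 0 < \<alpha> \<and>
       (\<lambda>N. measure_pmf.prob (random_hypergraph k \<alpha> N) {E. hypercore E = {}}) \<longlonglongrightarrow> 1})"

section \<open>Qubits\<close>

text \<open>The Hilbert space of a finite set \<open>I\<close> of qubits is the space of complex functions on the
  computational basis \<open>basis I\<close>. Basis states and vectors are extensional functions.\<close>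

definition basis :: "nat set \<Rightarrow> (nat \<Rightarrow> bool) set" where
  "basis I = (I \<rightarrow>\<^sub>E UNIV)"

type_synonym qvec = "(nat \<Rightarrow> bool) \<Rightarrow> complex"

definition qspace :: "nat set \<Rightarrow> qvec set" where
  "qspace I = (basis I \<rightarrow>\<^sub>E UNIV)"

definition qzero :: "nat set \<Rightarrow> qvec" where
  "qzero I = (\<lambda>x\<in>basis I. 0)"

definition qnorm :: "nat set \<Rightarrow> qvec \<Rightarrow> real" where
  "qnorm I \<phi> = sqrt (\<Sum>x\<in>basis I. (cmod (\<phi> x))\<^sup>2)"

definition ketbra :: "qvec \<Rightarrow> (nat \<Rightarrow> bool) \<Rightarrow> (nat \<Rightarrow> bool) \<Rightarrow> complex" where
  "ketbra \<phi> x y = \<phi> x * cnj (\<phi> y)"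

text \<open>The operator with matrix \<open>A\<close> on the qubits in \<open>I\<close>, tensored with the identity on the other
  qubits in \<open>Q\<close>: its matrix entry at \<open>(x, x')\<close> is \<open>A (x|I) (x'|I)\<close> if \<open>x\<close> and \<open>x'\<close> agree outside
  \<open>I\<close>, and \<open>0\<close> otherwise.\<close>

definition act_on ::
  "nat set \<Rightarrow> nat set \<Rightarrow> ((nat \<Rightarrow> bool) \<Rightarrow> (nat \<Rightarrow> bool) \<Rightarrow> complex) \<Rightarrow> qvec \<Rightarrow> qvec" where
  "act_on Q I A \<psi> =
     (\<lambda>x\<in>basis Q. \<Sum>y\<in>basis I. A (restrict x I) y * \<psi> (override_on x y I))"

definition hamiltonian :: "nat \<Rightarrow> nat set set \<Rightarrow> (nat set \<Rightarrow> qvec) \<Rightarrow> qvec \<Rightarrow> qvec" where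
  "hamiltonian N E \<phi> \<psi> =
     (\<lambda>x\<in>basis {..<N}. \<Sum>I\<in>E. act_on {..<N} I (ketbra (\<phi> I)) \<psi> x)"

definition qkernel :: "nat \<Rightarrow> (qvec \<Rightarrow> qvec) \<Rightarrow> qvec set" where
  "qkernel N H = {\<psi> \<in> qspace {..<N}. H \<psi> = qzero {..<N}}"

definition satisfiable :: "nat \<Rightarrow> nat set set \<Rightarrow> (nat set \<Rightarrow> qvec) \<Rightarrow> bool" where
  "satisfiable N E \<phi> \<longleftrightarrow> qkernel N (hamiltonian N E \<phi>) \<noteq> {qzero {..<N}}"

section \<open>Random instances\<close>

text \<open>The uniform probability measure on the unit sphere, as the cone measure: the radial projection
  of normalised Lebesgue measure on the unit ball. This is the unitarily invariant (Haar)
  probability measure on the sphere, because Lebesgue measure, the ball and the radial projection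
  are all preserved by unitary maps.\<close>

definition qlebesgue :: "nat set \<Rightarrow> qvec measure" where
  "qlebesgue I = PiM (basis I) (\<lambda>_. lborel)"

definition qball :: "nat set \<Rightarrow> qvec set" where
  "qball I = {\<phi> \<in> qspace I. qnorm I \<phi> \<le> 1}"

definition qnormalize :: "nat set \<Rightarrow> qvec \<Rightarrow> qvec" where
  "qnormalize I \<phi> = (\<lambda>x\<in>basis I. \<phi> x / complex_of_real (qnorm I \<phi>))"

definition haar_sphere :: "nat set \<Rightarrow> qvec measure" where
  "haar_sphere I =
     distr (uniform_measure (qlebesgue I) (qball I)) (PiM (basis I) (\<lambda>_. borel)) (qnormalize I)"

lemma finite_basis: "finite I \<Longrightarrow> finite (basis I)"
  unfolding basis_def by (rule finite_PiE) auto

lemma qnorm_measurable [measurable]: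
  "qnorm I \<in> borel_measurable (PiM (basis I) (\<lambda>_. borel))"
  unfolding qnorm_def by measurable

lemma sets_qlebesgue [measurable_cong]: "sets (qlebesgue I) = sets (PiM (basis I) (\<lambda>_. borel))"
  unfolding qlebesgue_def by (rule sets_PiM_cong) auto

lemma space_qlebesgue: "space (qlebesgue I) = qspace I"
  by (simp add: qlebesgue_def space_PiM qspace_def)

lemma qball_sets [measurable]: "qball I \<in> sets (PiM (basis I) (\<lambda>_. borel))"
proof -
  have "qball I = {\<phi> \<in> space (PiM (basis I) (\<lambda>_. borel)). qnorm I \<phi> \<le> 1}"
    by (simp add: qball_def space_PiM qspace_def)
  then show ?thesis by simp
qed

lemma qnormalize_measurable [measurable]:
  "qnormalize I \<in> measurable (PiM (basis I) (\<lambda>_. borel)) (PiM (basis I) (\<lambda>_. borel))"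
  unfolding qnormalize_def by measurable

lemma emeasure_qball:
  assumes "finite I"
  shows "0 < emeasure (qlebesgue I) (qball I)" "emeasure (qlebesgue I) (qball I) < \<infinity>"
proof -
  interpret product_sigma_finite "\<lambda>_::nat \<Rightarrow> bool. lborel :: complex measure" ..
  note fin = finite_basis[OF assms]
  have box: "emeasure (qlebesgue I) (PiE (basis I) (\<lambda>_. cball 0 r)) =
      emeasure lborel (cball (0::complex) r) ^ card (basis I)" for r
    unfolding qlebesgue_def by (subst emeasure_PiM[OF fin]) auto
  have pos: "0 < emeasure lborel (cball (0::complex) r)" if "r > 0" for r
  proof -
    have "0 < measure lborel (cball (0::complex) r)" using content_cball_pos[OF that] by simp
    then have "emeasure lborel (cball (0::complex) r) \<noteq> 0"
      unfolding measure_def by (metis enn2real_0 less_irrefl)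
    then show ?thesis by (simp add: zero_less_iff_neq_zero)
  qed
  define n where "n = card (basis I)"
  have "basis I \<noteq> {}" unfolding basis_def by (simp add: PiE_eq_empty_iff)
  then have n: "n > 0" using fin by (simp add: n_def card_gt_0_iff)
  have "PiE (basis I) (\<lambda>_. cball 0 (1 / real n)) \<subseteq> qball I"
  proof
    fix \<phi> :: qvec assume \<phi>: "\<phi> \<in> PiE (basis I) (\<lambda>_. cball 0 (1 / real n))"
    have "(\<Sum>x\<in>basis I. (cmod (\<phi> x))\<^sup>2) \<le> (\<Sum>x\<in>basis I. 1 / real n)"
    proof (rule sum_mono)
      fix x assume "x \<in> basis I"
      then have "cmod (\<phi> x) \<le> 1 / real n" using \<phi> by (auto simp: PiE_iff)
      moreover have "1 / real n \<le> 1" using n by simp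
      ultimately have "cmod (\<phi> x) * cmod (\<phi> x) \<le> 1 / real n * 1"
        by (intro mult_mono) auto
      then show "(cmod (\<phi> x))\<^sup>2 \<le> 1 / real n" by (simp add: power2_eq_square)
    qed
    also have "\<dots> = 1" using n by (simp add: n_def)
    finally show "\<phi> \<in> qball I" using \<phi> by (auto simp: qball_def qspace_def qnorm_def PiE_iff)
  qed
  then have le: "emeasure lborel (cball (0::complex) (1 / real n)) ^ card (basis I)
      \<le> emeasure (qlebesgue I) (qball I)"
    unfolding box[symmetric] by (rule emeasure_mono) simp
  have "emeasure lborel (cball (0::complex) (1 / real n)) \<noteq> 0"
    using pos[of "1 / real n"] n by auto
  then have "emeasure lborel (cball (0::complex) (1 / real n)) ^ card (basis I) \<noteq> 0"
    by (rule power_not_zero)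
  then have "0 < emeasure lborel (cball (0::complex) (1 / real n)) ^ card (basis I)"
    unfolding zero_less_iff_neq_zero .
  then show "0 < emeasure (qlebesgue I) (qball I)" using le by (rule less_le_trans)
  have "qball I \<subseteq> PiE (basis I) (\<lambda>_. cball 0 1)"
  proof
    fix \<phi> assume \<phi>: "\<phi> \<in> qball I"
    have "cmod (\<phi> x) \<le> 1" if "x \<in> basis I" for x
    proof -
      have "(cmod (\<phi> x))\<^sup>2 \<le> (\<Sum>x\<in>basis I. (cmod (\<phi> x))\<^sup>2)"
        using fin that by (intro member_le_sum) auto
      also have "\<dots> \<le> 1" using \<phi> by (simp add: qball_def qnorm_def)
      finally show ?thesis by (simp add: power_le_one_iff abs_square_le_1)
    qed
    then show "\<phi> \<in> PiE (basis I) (\<lambda>_. cball 0 1)"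
      using \<phi> by (auto simp: qball_def qspace_def PiE_iff)
  qed
  then have "emeasure (qlebesgue I) (qball I) \<le> emeasure lborel (cball (0::complex) 1) ^ card (basis I)"
    unfolding box[symmetric]
    by (rule emeasure_mono) (auto simp: qlebesgue_def intro!: sets_PiM_I_finite fin)
  also have "\<dots> < \<infinity>"
    using emeasure_lborel_cball_finite[of "0::complex" 1] by (auto simp: power_less_top_ennreal)
  finally show "emeasure (qlebesgue I) (qball I) < \<infinity>" .
qed

lemma prob_space_haar_sphere:
  assumes "finite I"
  shows "prob_space (haar_sphere I)"
  unfolding haar_sphere_def
proof (rule prob_space.prob_space_distr)
  show "prob_space (uniform_measure (qlebesgue I) (qball I))"
    using emeasure_qball[OF assms] by (intro prob_space_uniform_measure) auto
qed measurable

lemma AE_haar_sphere_unit: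
  assumes "finite I"
  shows "AE \<phi> in haar_sphere I. qnorm I \<phi> = 1"
proof -
  interpret product_sigma_finite "\<lambda>_::nat \<Rightarrow> bool. lborel :: complex measure" ..
  note fin = finite_basis[OF assms]
  have ne: "basis I \<noteq> {}" unfolding basis_def by (simp add: PiE_eq_empty_iff)
  have "emeasure (qlebesgue I) (PiE (basis I) (\<lambda>_. {0})) = 0"
    unfolding qlebesgue_def using ne fin by (subst emeasure_PiM[OF fin]) (auto simp: card_gt_0_iff)
  moreover have "PiE (basis I) (\<lambda>_. {0}) \<in> sets (qlebesgue I)"
    unfolding qlebesgue_def by (intro sets_PiM_I_finite fin) auto
  ultimately have "AE \<phi> in qlebesgue I. \<phi> \<notin> PiE (basis I) (\<lambda>_. {0})"
    by (intro AE_not_in) (auto simp: null_sets_def)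
  moreover have "qnorm I (qnormalize I \<phi>) = 1"
    if \<phi>: "\<phi> \<in> space (qlebesgue I)" "\<phi> \<notin> PiE (basis I) (\<lambda>_. {0})" for \<phi>
  proof -
    obtain x where x: "x \<in> basis I" "\<phi> x \<noteq> 0"
      using \<phi> unfolding space_qlebesgue qspace_def PiE_iff by blast
    have "0 < (cmod (\<phi> x))\<^sup>2" using x by simp
    also have "\<dots> \<le> (\<Sum>x\<in>basis I. (cmod (\<phi> x))\<^sup>2)" using fin x by (intro member_le_sum) auto
    finally have pos: "0 < (\<Sum>x\<in>basis I. (cmod (\<phi> x))\<^sup>2)" .
    have "(\<Sum>x\<in>basis I. (cmod (qnormalize I \<phi> x))\<^sup>2) =
        (\<Sum>x\<in>basis I. (cmod (\<phi> x))\<^sup>2 / (qnorm I \<phi>)\<^sup>2)"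
      by (intro sum.cong) (auto simp: qnormalize_def norm_divide power_divide)
    also have "\<dots> = (\<Sum>x\<in>basis I. (cmod (\<phi> x))\<^sup>2) / (qnorm I \<phi>)\<^sup>2"
      by (simp add: sum_divide_distrib)
    also have "\<dots> = 1" using pos by (simp add: qnorm_def)
    finally show ?thesis unfolding qnorm_def[of I "qnormalize I \<phi>"] by simp
  qed
  ultimately have "AE \<phi> in qlebesgue I. qnorm I (qnormalize I \<phi>) = 1"
    using AE_space by (auto elim: eventually_elim2)
  then have "AE \<phi> in uniform_measure (qlebesgue I) (qball I). qnorm I (qnormalize I \<phi>) = 1"
    by (intro AE_uniform_measureI) (auto elim: eventually_mono)
  then show ?thesis
    unfolding haar_sphere_def by (subst AE_distr_iff) measurable
qed

text \<open>Independent vectors are drawn for all \<open>k\<close>-subsets, also for those that are not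
  edges. The Hamiltonian uses only those at the edges, and given the edges these are independent
  and uniform.\<close>

definition random_instance ::
  "nat \<Rightarrow> real \<Rightarrow> nat \<Rightarrow> (nat set set \<times> (nat set \<Rightarrow> qvec)) measure" where
  "random_instance k \<alpha> N =
     measure_pmf (random_hypergraph k \<alpha> N) \<Otimes>\<^sub>M PiM (ksubsets k N) haar_sphere"

end

theory Submission
  imports Defs "Jordan_Normal_Form.Determinant"
begin

unbundle no vec_syntax

section \<open>Stripping and satisfiability\<close>

text \<open>A stripping order of \<open>E\<close> restricts to \<open>F\<close>: a node whose only
  edge in \<open>E\<close> is \<open>e\<close> has \<open>e\<close> as its only edge in
  \<open>F\<close> if \<open>e\<close> survives there, and otherwise the step is skipped. So having
  an empty hypercore passes to subhypergraphs, which is what the coupling of two densities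
  needs.\<close>

lemma strip_empty_subset:
  assumes "strip\<^sup>*\<^sup>* E {}" "F \<subseteq> E"
  shows "strip\<^sup>*\<^sup>* F {}"
  using assms
proof (induction arbitrary: F rule: converse_rtranclp_induct)
  case base
  then show ?case by simp
next
  case (step E E')
  then obtain e v where e: "e \<in> E" "v \<in> e" "node_degree E v = 1" "E' = E - {e}"
    by (auto elim: strip.cases)
  show ?case
  proof (cases "e \<in> F")
    case True
    obtain x where x: "{d \<in> E. v \<in> d} = {x}"
      using e(3) unfolding node_degree_def by (auto simp: card_1_singleton_iff)
    have "d = e" if "d \<in> E" "v \<in> d" for d
    proof -
      have "d \<in> {x}" "e \<in> {x}" unfolding x[symmetric] using that e(1,2) by simp_all
      then show ?thesis by simp
    qed
    then have "{d \<in> F. v \<in> d} = {e}"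
      using e(2) True step.prems by auto
    then have "strip F (F - {e})"
      using True e(2) by (intro strip.strip[of e F v]) (auto simp: node_degree_def)
    moreover have "strip\<^sup>*\<^sup>* (F - {e}) {}"
      using step.prems e(4) by (intro step.IH) auto
    ultimately show ?thesis by (rule converse_rtranclp_into_rtranclp)
  next
    case False
    then show ?thesis using step.prems e(4) by (intro step.IH) auto
  qed
qed

text \<open>The empty hypergraph cannot be stripped further, so if it is reachable it is the unique
  normal form that the definite description in \<open>hypercore\<close> picks.\<close>

lemma hypercore_eq_empty_iff:
  assumes "finite E"
  shows "hypercore E = {} \<longleftrightarrow> strip\<^sup>*\<^sup>* E {}"
proof -
  have "\<nexists>D. strip {} D" by (auto elim: strip.cases)
  then show ?thesis
    using theI'[OF hypercore_ex1[OF assms]] the1_equality[OF hypercore_ex1[OF assms], of "{}"]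
    unfolding hypercore_def by metis
qed

text \<open>An edge with a private node \<open>v\<close> imposes a single linear equation on the state of the qubit
  \<open>v\<close> once the other qubits are fixed, and no other edge sees \<open>v\<close>. Hence a product state can be
  built by adding the edges back in the reverse order of stripping.\<close>

lemma strip_empty_product_state:
  fixes \<phi> :: "nat set \<Rightarrow> qvec"
  assumes "strip\<^sup>*\<^sup>* E {}" "\<And>I. I \<in> E \<Longrightarrow> finite I"
  shows "\<exists>s :: nat \<Rightarrow> bool \<Rightarrow> complex. (\<forall>u. \<exists>b. s u b \<noteq> 0) \<and>
    (\<forall>I\<in>E. (\<Sum>y\<in>basis I. cnj (\<phi> I y) * (\<Prod>u\<in>I. s u (y u))) = 0)"
  using assms
proof (induction rule: converse_rtranclp_induct)
  case base
  show ?case by (rule exI[of _ "\<lambda>_ _. 1"]) simp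
next
  case (step E E')
  then obtain e v where e: "e \<in> E" "v \<in> e" "node_degree E v = 1" "E' = E - {e}"
    by (auto elim: strip.cases)
  have fe: "finite e" using e step.prems by blast
  have "\<exists>s :: nat \<Rightarrow> bool \<Rightarrow> complex. (\<forall>u. \<exists>b. s u b \<noteq> 0) \<and>
    (\<forall>I\<in>E'. (\<Sum>y\<in>basis I. cnj (\<phi> I y) * (\<Prod>u\<in>I. s u (y u))) = 0)"
    using step.prems e(4) by (intro step.IH) auto
  then obtain s :: "nat \<Rightarrow> bool \<Rightarrow> complex" where s: "\<And>u. \<exists>b. s u b \<noteq> 0"
    "\<And>I. I \<in> E' \<Longrightarrow> (\<Sum>y\<in>basis I. cnj (\<phi> I y) * (\<Prod>u\<in>I. s u (y u))) = 0" by blast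
  \<comment> \<open>With the other qubits of \<open>e\<close> fixed in their states
    \<open>s u\<close>, the equation of \<open>e\<close> is linear in the state of \<open>v\<close>;
    \<open>c b\<close> is the coefficient of its amplitude at \<open>b\<close>.\<close>
  define c where "c b = (\<Sum>y\<in>{y\<in>basis e. y v = b}. cnj (\<phi> e y) * (\<Prod>u\<in>e - {v}. s u (y u)))" for b
  \<comment> \<open>One linear equation in two unknowns has a nonzero solution: swap the
    coefficients and change one sign. If both vanish, this vector would be zero, so the constant 1
    is taken instead.\<close>
  define t where "t b = (if c True = 0 \<and> c False = 0 then 1 else if b then - c False else c True)" for b
  define s' where "s' = s(v := t)"
  have t: "t True * c True + t False * c False = 0" "\<exists>b. t b \<noteq> 0"
    unfolding t_def by (auto split: if_splits)
  have "\<exists>b. s' u b \<noteq> 0" for u using s(1) t(2) by (simp add: s'_def)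
  moreover have "(\<Sum>y\<in>basis I. cnj (\<phi> I y) * (\<Prod>u\<in>I. s' u (y u))) = 0" if I: "I \<in> E" for I
  proof (cases "I = e")
    case True
    have split: "(\<Prod>u\<in>e. s' u (y u)) = t (y v) * (\<Prod>u\<in>e - {v}. s u (y u))" for y
    proof -
      have "(\<Prod>u\<in>e - {v}. s' u (y u)) = (\<Prod>u\<in>e - {v}. s u (y u))"
        by (intro prod.cong) (auto simp: s'_def)
      then show ?thesis using prod.remove[OF fe e(2), of "\<lambda>u. s' u (y u)"] by (simp add: s'_def)
    qed
    have part: "(\<Sum>y\<in>{y\<in>basis e. y v = b}. cnj (\<phi> e y) * (\<Prod>u\<in>e. s' u (y u))) = t b * c b" for b
      unfolding c_def sum_distrib_left split by (intro sum.cong) auto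
    have "basis e = {y\<in>basis e. y v = True} \<union> {y\<in>basis e. y v = False}" by auto
    then have "(\<Sum>y\<in>basis e. cnj (\<phi> e y) * (\<Prod>u\<in>e. s' u (y u))) =
        (\<Sum>y\<in>{y\<in>basis e. y v = True} \<union> {y\<in>basis e. y v = False}.
          cnj (\<phi> e y) * (\<Prod>u\<in>e. s' u (y u)))" by simp
    also have "\<dots> = t True * c True + t False * c False"
      unfolding part[symmetric] using finite_basis[OF fe] by (intro sum.union_disjoint) auto
    finally show ?thesis using t(1) True by simp
  next
    case False
    \<comment> \<open>As \<open>v\<close> has degree 1, its only edge is \<open>e\<close>; the
      product over any other edge does not involve the changed state of \<open>v\<close>.\<close>
    obtain x where "{d \<in> E. v \<in> d} = {x}"
      using e(3) unfolding node_degree_def by (auto simp: card_1_singleton_iff)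
    then have "v \<notin> I" using e False I by auto
    then have "(\<Prod>u\<in>I. s' u (y u)) = (\<Prod>u\<in>I. s u (y u))" for y
      by (intro prod.cong) (auto simp: s'_def)
    then show ?thesis using s(2)[of I] I False e(4) by simp
  qed
  ultimately show ?case by blast
qed

text \<open>On a product state the rank-one operator of an edge \<open>I\<close> factors: the qubits
  outside \<open>I\<close> give a common factor, and those in \<open>I\<close> give the inner
  product with \<open>\<phi> I\<close>, which vanishes by the choice of the states. Each term of the
  Hamiltonian thus annihilates the state.\<close>

lemma strip_empty_satisfiable:
  assumes "strip\<^sup>*\<^sup>* E {}" and sub: "E \<subseteq> Pow {..<N}"
  shows "satisfiable N E \<phi>"
proof -
  have fin: "finite I" if "I \<in> E" for I
    using that sub by (meson PowD finite_lessThan finite_subset subsetD)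
  obtain s :: "nat \<Rightarrow> bool \<Rightarrow> complex" where s: "\<And>u. \<exists>b. s u b \<noteq> 0"
    "\<And>I. I \<in> E \<Longrightarrow> (\<Sum>y\<in>basis I. cnj (\<phi> I y) * (\<Prod>u\<in>I. s u (y u))) = 0"
    using strip_empty_product_state[OF assms(1), of \<phi>] fin by blast
  define \<psi> :: qvec where "\<psi> = (\<lambda>x\<in>basis {..<N}. \<Prod>u<N. s u (x u))"
  have zero: "act_on {..<N} I (ketbra (\<phi> I)) \<psi> x = 0" if I: "I \<in> E" and x: "x \<in> basis {..<N}" for I x
  proof -
    have IN: "I \<subseteq> {..<N}" using I sub by auto
    have "\<psi> (override_on x y I) = (\<Prod>u\<in>I. s u (y u)) * (\<Prod>u\<in>{..<N} - I. s u (x u))"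
      if y: "y \<in> basis I" for y
    proof -
      have "override_on x y I \<in> basis {..<N}"
        using x y IN by (auto simp: basis_def override_on_def PiE_iff extensional_def)
      then have "\<psi> (override_on x y I) = (\<Prod>u\<in>{..<N}. s u (override_on x y I u))"
        by (simp add: \<psi>_def)
      also have "\<dots> = (\<Prod>u\<in>{..<N} - I. s u (override_on x y I u)) * (\<Prod>u\<in>I. s u (override_on x y I u))"
        by (rule prod.subset_diff[OF IN]) simp
      also have "\<dots> = (\<Prod>u\<in>{..<N} - I. s u (x u)) * (\<Prod>u\<in>I. s u (y u))"
        by (intro arg_cong2[where f = "(*)"] prod.cong) auto
      finally show ?thesis by (simp add: mult.commute)
    qed
    then have "act_on {..<N} I (ketbra (\<phi> I)) \<psi> x =
      \<phi> I (restrict x I) * (\<Prod>u\<in>{..<N} - I. s u (x u)) *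
        (\<Sum>y\<in>basis I. cnj (\<phi> I y) * (\<Prod>u\<in>I. s u (y u)))"
      using x unfolding act_on_def ketbra_def sum_distrib_left
      by (auto intro!: sum.cong simp: mult_ac)
    then show ?thesis using s(2)[OF I] by simp
  qed
  have "\<psi> \<in> qkernel N (hamiltonian N E \<phi>)"
    unfolding qkernel_def hamiltonian_def qzero_def
    using zero by (auto simp: qspace_def \<psi>_def intro!: restrict_ext)
  moreover have "\<psi> \<noteq> qzero {..<N}"
  proof
    assume *: "\<psi> = qzero {..<N}"
    \<comment> \<open>Choosing at every qubit a bit of nonzero amplitude gives a basis state at
      which the product \<open>\<psi>\<close> does not vanish.\<close>
    obtain b where b: "\<And>u. s u (b u) \<noteq> 0" using s(1) by metis
    have x: "restrict b {..<N} \<in> basis {..<N}" by (simp add: basis_def)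
    have "\<psi> (restrict b {..<N}) = (\<Prod>u<N. s u (b u))" using x by (simp add: \<psi>_def)
    also have "\<dots> \<noteq> 0" using b by simp
    finally show False using x by (simp add: * qzero_def)
  qed
  ultimately show ?thesis by (auto simp: satisfiable_def)
qed

section \<open>Measurability of satisfiability\<close>

text \<open>The existential ranges over uncountably many \<open>\<psi>\<close>, so measurability
  does not follow from closure under countable unions. It is replaced by the vanishing of a
  determinant, a polynomial in the matrix entries.\<close>

lemma pred_nontrivial_kernel:
  fixes A :: "'a \<Rightarrow> 'i \<Rightarrow> 'i \<Rightarrow> complex"
  assumes B: "finite B"
    and meas: "\<And>x y. x \<in> B \<Longrightarrow> y \<in> B \<Longrightarrow> (\<lambda>\<omega>. A \<omega> x y) \<in> borel_measurable M"
  shows "Measurable.pred M (\<lambda>\<omega>. \<exists>\<psi>. (\<exists>y\<in>B. \<psi> y \<noteq> 0) \<and> (\<forall>x\<in>B. (\<Sum>y\<in>B. A \<omega> x y * \<psi> y) = 0))"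
proof -
  define n where "n = card B"
  obtain h where h: "bij_betw h {0..<n} B"
    using ex_bij_betw_nat_finite[OF B] by (auto simp: n_def)
  have hB: "h i \<in> B" if "i < n" for i using that h by (auto simp: bij_betw_def)
  \<comment> \<open>The enumeration \<open>h\<close> of \<open>B\<close> turns the family
    \<open>A \<omega>\<close> into a square matrix indexed by numbers, to which determinants
    apply.\<close>
  define T where "T \<omega> = mat n n (\<lambda>(i, j). A \<omega> (h i) (h j))" for \<omega>
  have T: "T \<omega> \<in> carrier_mat n n" for \<omega> by (simp add: T_def)
  have Tv: "(T \<omega> *\<^sub>v v = 0\<^sub>v n) \<longleftrightarrow> (\<forall>i<n. (\<Sum>j<n. A \<omega> (h i) (h j) * v $ j) = 0)"
    if "v \<in> carrier_vec n" for \<omega> v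
    using that by (auto simp: T_def vec_eq_iff scalar_prod_def lessThan_atLeast0)
  have reindex: "(\<Sum>y\<in>B. f y) = (\<Sum>j<n. f (h j))" for f :: "'i \<Rightarrow> complex"
    using sum.reindex_bij_betw[OF h, of f] by (simp add: lessThan_atLeast0)
  have all: "(\<forall>x\<in>B. P x) \<longleftrightarrow> (\<forall>i<n. P (h i))" for P
    using h by (auto simp: bij_betw_def)
  have ex: "(\<exists>x\<in>B. P x) \<longleftrightarrow> (\<exists>i<n. P (h i))" for P
    using h by (auto simp: bij_betw_def)
  have eq: "(\<exists>\<psi>. (\<exists>y\<in>B. \<psi> y \<noteq> 0) \<and> (\<forall>x\<in>B. (\<Sum>y\<in>B. A \<omega> x y * \<psi> y) = 0)) \<longleftrightarrow> det (T \<omega>) = 0" for \<omega>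
    unfolding det_0_iff_vec_prod_zero_field[OF T] all ex reindex
  proof safe
    fix \<psi> i assume *: "\<forall>i<n. (\<Sum>j<n. A \<omega> (h i) (h j) * \<psi> (h j)) = 0" "i < n" "\<psi> (h i) \<noteq> 0"
    define v where "v = vec n (\<lambda>i. \<psi> (h i))"
    have v: "v \<in> carrier_vec n" by (simp add: v_def)
    have "v $ i \<noteq> 0\<^sub>v n $ i" using * by (simp add: v_def)
    then have "v \<noteq> 0\<^sub>v n" by metis
    moreover have "T \<omega> *\<^sub>v v = 0\<^sub>v n" using * by (simp add: Tv[OF v]) (simp add: v_def)
    ultimately show "\<exists>v. v \<in> carrier_vec n \<and> v \<noteq> 0\<^sub>v n \<and> T \<omega> *\<^sub>v v = 0\<^sub>v n" using v by blast
  next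
    fix v assume v: "v \<in> carrier_vec n" "v \<noteq> 0\<^sub>v n" "T \<omega> *\<^sub>v v = 0\<^sub>v n"
    define \<psi> where "\<psi> y = v $ inv_into {0..<n} h y" for y
    have "inv_into {0..<n} h (h j) = j" if "j < n" for j
      using h that by (intro inv_into_f_f) (auto simp: bij_betw_def)
    then have \<psi>: "\<psi> (h j) = v $ j" if "j < n" for j using that by (simp add: \<psi>_def)
    show "\<exists>\<psi>. (\<exists>i<n. \<psi> (h i) \<noteq> 0) \<and> (\<forall>i<n. (\<Sum>j<n. A \<omega> (h i) (h j) * \<psi> (h j)) = 0)"
    proof (intro exI[of _ \<psi>] conjI)
      show "\<exists>i<n. \<psi> (h i) \<noteq> 0" using v(1,2) \<psi> by (auto simp: vec_eq_iff)
      show "\<forall>i<n. (\<Sum>j<n. A \<omega> (h i) (h j) * \<psi> (h j)) = 0"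
        using v(3) \<psi> unfolding Tv[OF v(1)] by simp
    qed
  qed
  have "det (T \<omega>) = (\<Sum>p | p permutes {0..<n}. signof p * (\<Prod>i = 0..<n. A \<omega> (h i) (h (p i))))" for \<omega>
    unfolding det_def'[OF T]
    by (intro sum.cong arg_cong2[where f = "(*)"] prod.cong) (auto simp: T_def permutes_def)
  moreover have "(\<lambda>\<omega>. \<Sum>p | p permutes {0..<n}. signof p * (\<Prod>i = 0..<n. A \<omega> (h i) (h (p i))))
      \<in> borel_measurable M"
  proof (intro borel_measurable_sum borel_measurable_times borel_measurable_const
      borel_measurable_prod meas)
    fix p i assume p: "p \<in> {p. p permutes {0..<n}}" and i: "i \<in> {0..<n}"
    then have "p i \<in> {0..<n}" by (simp add: permutes_in_image)
    then show "h (p i) \<in> B" "h i \<in> B" using i by (auto intro: hB)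
  qed
  ultimately have [measurable]: "(\<lambda>\<omega>. det (T \<omega>)) \<in> borel_measurable M" by simp
  show ?thesis unfolding eq by measurable
qed

text \<open>The indicators of single qubits are already infinitely many basis states. This is what
  makes sums over \<open>basis I\<close> take their default value 0 for an infinite
  \<open>I\<close>.\<close>

lemma infinite_basis: "infinite I \<Longrightarrow> infinite (basis I)"
proof
  assume I: "infinite I" and fin: "finite (basis I)"
  have "inj_on (\<lambda>u. \<lambda>w\<in>I. w = u) I" by (auto simp: inj_on_def fun_eq_iff restrict_def)
  moreover have "(\<lambda>u. \<lambda>w\<in>I. w = u) ` I \<subseteq> basis I" by (auto simp: basis_def)
  ultimately show False using I fin by (meson finite_imageD finite_subset)
qed

lemma haar_sphere_entry_measurable:
  assumes "y \<in> basis I"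
  shows "(\<lambda>\<phi>. \<phi> I y) \<in> borel_measurable (PiM K haar_sphere)"
proof (cases "I \<in> K")
  case True
  have 1: "(\<lambda>\<phi>. \<phi> I) \<in> PiM K haar_sphere \<rightarrow>\<^sub>M haar_sphere I"
    using True by (rule measurable_component_singleton)
  have 2: "(\<lambda>f. f y) \<in> borel_measurable (haar_sphere I)"
    using assms by (simp add: haar_sphere_def measurable_component_singleton)
  show ?thesis using measurable_compose[OF 1 2] .
next
  case False
  \<comment> \<open>Members of the product space are extensional, so at an index outside
    \<open>K\<close> the entry is a constant.\<close>
  then have "\<phi> I y = (undefined :: qvec) y" if "\<phi> \<in> space (PiM K haar_sphere)" for \<phi>
    using that by (auto simp: space_PiM PiE_iff extensional_def)
  then show ?thesis by (subst measurable_cong[where g = "\<lambda>_. (undefined :: qvec) y"]) auto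
qed

text \<open>Edges that are not subsets of \<open>{..<N}\<close> have probability zero, but they do occur in the
  underlying space. For them \<^const>\<open>act_on\<close> reads the vector outside its domain, so that the
  Hamiltonian is only affine in \<open>\<psi>\<close>.\<close>

lemma satisfiable_measurable_edges:
  "Measurable.pred (PiM K haar_sphere) (satisfiable N F)"
proof -
  let ?B = "basis {..<N}" and ?M = "PiM K haar_sphere"
  define c where "c \<phi> I x y = ketbra (\<phi> I) (restrict x I) y"
    for \<phi> :: "nat set \<Rightarrow> qvec" and I x y
  \<comment> \<open>\<open>A\<close> is the matrix of the linear part: it collects the terms in
    which overriding \<open>x\<close> by \<open>y\<close> on \<open>I\<close> hits the basis state
    \<open>z\<close>.\<close>
  define A where "A \<phi> x z =
      (\<Sum>I\<in>F. \<Sum>y\<in>basis I. c \<phi> I x y * (if override_on x y I = z then 1 else 0))" for \<phi> x z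
  \<comment> \<open>If \<open>I\<close> leaves \<open>{..<N}\<close>, the overridden state may lie
    outside \<open>?B\<close>, where an extensional \<open>\<psi>\<close> equals
    \<open>undefined\<close>. These terms form the constant part.\<close>
  define b where "b \<phi> x =
      (\<Sum>I\<in>F. \<Sum>y\<in>basis I. c \<phi> I x y * (if override_on x y I \<in> ?B then 0 else undefined))" for \<phi> x
  have B: "finite ?B" by (simp add: finite_basis)
  have c_meas: "(\<lambda>\<phi>. c \<phi> I x y) \<in> borel_measurable ?M" if "y \<in> basis I" for I x y
  proof -
    have x: "restrict x I \<in> basis I" by (simp add: basis_def)
    have cnj: "cnj \<in> borel_measurable borel"
      by (intro borel_measurable_continuous_onI continuous_intros)
    show ?thesis unfolding c_def ketbra_def
      using x measurable_compose[OF haar_sphere_entry_measurable[OF that] cnj]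
      by (intro borel_measurable_times haar_sphere_entry_measurable)
  qed
  have A_meas: "(\<lambda>\<phi>. A \<phi> x z) \<in> borel_measurable ?M" for x z
    unfolding A_def by (intro borel_measurable_sum borel_measurable_times c_meas) auto
  have b_meas: "(\<lambda>\<phi>. b \<phi> x) \<in> borel_measurable ?M" for x
    unfolding b_def by (intro borel_measurable_sum borel_measurable_times c_meas) auto
  have H: "hamiltonian N F \<phi> \<psi> x = b \<phi> x + (\<Sum>z\<in>?B. A \<phi> x z * \<psi> z)"
    if \<psi>: "\<psi> \<in> qspace {..<N}" and x: "x \<in> ?B" for \<phi> \<psi> x
  proof -
    have val: "\<psi> w = (if w \<in> ?B then 0 else undefined) + (\<Sum>z\<in>?B. (if w = z then 1 else 0) * \<psi> z)" for w
    proof -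
      have "(\<Sum>z\<in>?B. (if w = z then 1 else 0) * \<psi> z) = (\<Sum>z\<in>?B. if w = z then \<psi> z else 0)"
        by (intro sum.cong) auto
      also have "\<dots> = (if w \<in> ?B then \<psi> w else 0)" using B by simp
      finally show ?thesis using \<psi> by (auto simp: qspace_def PiE_iff extensional_def)
    qed
    have "hamiltonian N F \<phi> \<psi> x = (\<Sum>I\<in>F. \<Sum>y\<in>basis I. c \<phi> I x y * \<psi> (override_on x y I))"
      using x by (simp add: hamiltonian_def act_on_def c_def)
    also have "\<dots> = b \<phi> x + (\<Sum>I\<in>F. \<Sum>y\<in>basis I. \<Sum>z\<in>?B.
        c \<phi> I x y * (if override_on x y I = z then 1 else 0) * \<psi> z)"
      unfolding b_def sum.distrib[symmetric]
      by (intro sum.cong refl, subst val) (simp add: distrib_left sum_distrib_left mult.assoc)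
    also have "(\<Sum>I\<in>F. \<Sum>y\<in>basis I. \<Sum>z\<in>?B.
        c \<phi> I x y * (if override_on x y I = z then 1 else 0) * \<psi> z) = (\<Sum>z\<in>?B. A \<phi> x z * \<psi> z)"
    proof -
      have "(\<Sum>z\<in>?B. A \<phi> x z * \<psi> z) = (\<Sum>I\<in>F. \<Sum>z\<in>?B. \<Sum>y\<in>basis I.
          c \<phi> I x y * (if override_on x y I = z then 1 else 0) * \<psi> z)"
        unfolding A_def sum_distrib_right by (rule sum.swap)
      also have "\<dots> = (\<Sum>I\<in>F. \<Sum>y\<in>basis I. \<Sum>z\<in>?B.
          c \<phi> I x y * (if override_on x y I = z then 1 else 0) * \<psi> z)"
        by (intro sum.cong refl sum.swap)
      finally show ?thesis by (rule sym)
    qed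
    finally show ?thesis .
  qed
  have ker: "\<psi> \<in> qkernel N (hamiltonian N F \<phi>) \<longleftrightarrow>
      \<psi> \<in> qspace {..<N} \<and> (\<forall>x\<in>?B. b \<phi> x + (\<Sum>z\<in>?B. A \<phi> x z * \<psi> z) = 0)" for \<phi> \<psi>
  proof -
    have 1: "hamiltonian N F \<phi> \<psi> = qzero {..<N} \<longleftrightarrow> (\<forall>x\<in>?B. hamiltonian N F \<phi> \<psi> x = 0)"
      unfolding qzero_def by (auto simp: hamiltonian_def fun_eq_iff restrict_def)
    show ?thesis unfolding qkernel_def mem_Collect_eq 1 by (intro conj_cong ball_cong refl) (simp only: H)
  qed
  have zero_space: "qzero {..<N} \<in> qspace {..<N}" by (simp add: qzero_def qspace_def)
  \<comment> \<open>A nonzero constant part keeps the zero vector out of the kernel, so the kernel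
    differs from its singleton and \<open>satisfiable\<close> holds, even for an empty kernel.
    Otherwise the system is homogeneous and only a nontrivial solution counts.\<close>
  have eq: "satisfiable N F \<phi> \<longleftrightarrow> \<not> (\<forall>x\<in>?B. b \<phi> x = 0) \<or>
      (\<exists>\<psi>. (\<exists>y\<in>?B. \<psi> y \<noteq> 0) \<and> (\<forall>x\<in>?B. (\<Sum>y\<in>?B. A \<phi> x y * \<psi> y) = 0))" for \<phi>
  proof (cases "\<forall>x\<in>?B. b \<phi> x = 0")
    case False
    then have "qzero {..<N} \<notin> qkernel N (hamiltonian N F \<phi>)"
      unfolding ker by (auto simp: qzero_def)
    then show ?thesis using False by (auto simp: satisfiable_def)
  next
    case True
    have ker': "\<psi> \<in> qkernel N (hamiltonian N F \<phi>) \<longleftrightarrow>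
      \<psi> \<in> qspace {..<N} \<and> (\<forall>x\<in>?B. (\<Sum>z\<in>?B. A \<phi> x z * \<psi> z) = 0)" for \<psi>
      using True by (simp add: ker)
    have "qzero {..<N} \<in> qkernel N (hamiltonian N F \<phi>)"
      unfolding ker' using zero_space by (simp add: qzero_def)
    then have "satisfiable N F \<phi> \<longleftrightarrow> (\<exists>\<psi>\<in>qkernel N (hamiltonian N F \<phi>). \<psi> \<noteq> qzero {..<N})"
      by (auto simp: satisfiable_def)
    also have "\<dots> \<longleftrightarrow> (\<exists>\<psi>. (\<exists>y\<in>?B. \<psi> y \<noteq> 0) \<and> (\<forall>x\<in>?B. (\<Sum>y\<in>?B. A \<phi> x y * \<psi> y) = 0))"
    proof safe
      fix \<psi> assume \<psi>: "\<psi> \<in> qkernel N (hamiltonian N F \<phi>)" "\<psi> \<noteq> qzero {..<N}"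
      have "\<exists>y\<in>?B. \<psi> y \<noteq> 0"
      proof (rule ccontr)
        assume "\<not> ?thesis"
        then have "\<psi> = qzero {..<N}"
          using \<psi>(1) unfolding ker' qspace_def qzero_def
          by (intro extensionalityI[of _ ?B]) (auto simp: PiE_iff)
        then show False using \<psi>(2) by simp
      qed
      then show "\<exists>\<psi>. (\<exists>y\<in>?B. \<psi> y \<noteq> 0) \<and> (\<forall>x\<in>?B. (\<Sum>y\<in>?B. A \<phi> x y * \<psi> y) = 0)"
        using \<psi>(1) unfolding ker' by blast
    next
      fix \<psi> y assume \<psi>: "\<forall>x\<in>?B. (\<Sum>y\<in>?B. A \<phi> x y * \<psi> y) = 0" "y \<in> ?B" "\<psi> y \<noteq> 0"
      have "restrict \<psi> ?B \<in> qkernel N (hamiltonian N F \<phi>)"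
        unfolding ker' using \<psi>(1) by (simp add: qspace_def)
      moreover have "restrict \<psi> ?B y \<noteq> qzero {..<N} y" using \<psi> by (simp add: qzero_def)
      ultimately show "\<exists>\<psi>\<in>qkernel N (hamiltonian N F \<phi>). \<psi> \<noteq> qzero {..<N}" by metis
    qed
    finally show ?thesis using True by simp
  qed
  note [measurable] = b_meas pred_nontrivial_kernel[OF B A_meas]
  have [measurable]: "countable ?B" using B by (rule countable_finite)
  show ?thesis unfolding eq[abs_def] using B by measurable
qed

text \<open>Sums over infinite sets are 0: an infinite edge set acts like the empty one, and an
  infinite edge contributes nothing. This leaves only countably many edge sets to
  distinguish.\<close>

lemma satisfiable_finite_edges:
  "satisfiable N E \<phi> = satisfiable N (if finite E then {I \<in> E. finite I} else {}) \<phi>"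
proof -
  have infinite: "act_on {..<N} I (ketbra (\<phi> I)) \<psi> x = 0"
    if "infinite I" "x \<in> basis {..<N}" for I \<psi> x
    using that infinite_basis by (simp add: act_on_def)
  have "(\<Sum>I\<in>E. act_on {..<N} I (ketbra (\<phi> I)) \<psi> x) =
      (\<Sum>I\<in>(if finite E then {I \<in> E. finite I} else {}). act_on {..<N} I (ketbra (\<phi> I)) \<psi> x)"
    if x: "x \<in> basis {..<N}" for \<psi> x
    by (cases "finite E") (auto intro!: sum.mono_neutral_right infinite[OF _ x])
  then have "hamiltonian N E \<phi> = hamiltonian N (if finite E then {I \<in> E. finite I} else {}) \<phi>"
    unfolding hamiltonian_def by (intro ext restrict_ext) auto
  then show ?thesis by (simp add: satisfiable_def)
qed

text \<open>The predicate is measurable in the vectors for each fixed edge set. These sections can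
  be glued over countably many edge sets, so the random edge set is first normalized by
  \<open>f\<close> into the countable set \<open>?C\<close>.\<close>

lemma satisfiable_measurable:
  "Measurable.pred (measure_pmf p \<Otimes>\<^sub>M PiM K haar_sphere) (\<lambda>\<omega>. satisfiable N (fst \<omega>) (snd \<omega>))"
proof -
  let ?C = "Fpow (Collect finite) :: nat set set set"
  let ?M = "measure_pmf p \<Otimes>\<^sub>M PiM K haar_sphere"
  define f :: "nat set set \<Rightarrow> nat set set" where
    "f E = (if finite E then {I \<in> E. finite I} else {})" for E
  have "(\<lambda>\<omega>. satisfiable N (f (fst \<omega>)) (snd \<omega>)) \<in> ?M \<rightarrow>\<^sub>M count_space UNIV"
  proof (rule measurable_compose_countable'[where I = ?C and f = "\<lambda>F \<omega>. satisfiable N F (snd \<omega>)"])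
    show "countable ?C"
      unfolding Fpow_def using countable_Collect_finite
      by (metis (no_types, lifting) Collect_cong countable_Collect_finite_subset)
    have "f \<in> measure_pmf p \<rightarrow>\<^sub>M count_space ?C" by (auto simp: f_def Fpow_def split: if_splits)
    then show "(\<lambda>\<omega>. f (fst \<omega>)) \<in> ?M \<rightarrow>\<^sub>M count_space ?C"
      by (rule measurable_compose[OF measurable_fst])
    show "(\<lambda>\<omega>. satisfiable N F (snd \<omega>)) \<in> ?M \<rightarrow>\<^sub>M count_space UNIV" for F
      by (rule measurable_compose[OF measurable_snd satisfiable_measurable_edges])
  qed
  then show ?thesis by (simp add: f_def satisfiable_finite_edges[symmetric])
qed

section \<open>Monotonicity in the clause density\<close>

lemma pmf_bernoulli_True_clamp: "pmf (bernoulli_pmf p) True = min 1 (max 0 p)"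
  by (simp add: bernoulli_pmf.rep_eq)

text \<open>Coupling by thinning: a success of the larger parameter is kept by an independent coin
  whose bias is the ratio of the two clamped parameters.\<close>

lemma rel_pmf_bernoulli_mono:
  assumes "p \<le> q"
  shows "rel_pmf (\<longrightarrow>) (bernoulli_pmf p) (bernoulli_pmf q)"
proof -
  define p' q' where "p' = min 1 (max 0 p)" and "q' = min 1 (max 0 q)"
  have pq: "0 \<le> p'" "p' \<le> q'" "q' \<le> 1" using assms by (auto simp: p'_def q'_def)
  \<comment> \<open>If \<open>q'\<close> is 0, then so is \<open>p'\<close>, and division by zero
    gives \<open>r = 0\<close>; the identity \<open>q' * r = p'\<close> survives.\<close>
  define r where "r = p' / q'"
  have r: "0 \<le> r" "r \<le> 1" "q' * r = p'" using pq by (auto simp: r_def divide_le_eq_1)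
  let ?J = "pair_pmf (bernoulli_pmf q') (bernoulli_pmf r)"
  have bool_eqI: "a = b" if "pmf a True = pmf b True" for a b :: "bool pmf"
  proof (rule pmf_eqI)
    have "pmf c False = 1 - pmf c True" for c :: "bool pmf"
    proof -
      have "(\<Sum>x\<in>UNIV. pmf c x) = 1" by (rule sum_pmf_eq_1) auto
      then show ?thesis by (simp add: UNIV_bool)
    qed
    then show "pmf a i = pmf b i" for i using that by (cases i) auto
  qed
  have q: "bernoulli_pmf q = bernoulli_pmf q'"
    using pq by (intro bool_eqI) (simp add: pmf_bernoulli_True_clamp[of q] q'_def)
  have "pmf (map_pmf (\<lambda>(b, c). b \<and> c) ?J) True = measure ?J {(True, True)}"
    by (simp add: pmf_map) (auto intro!: arg_cong[where f = "measure _"])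
  also have "\<dots> = p'" using pq r by (simp add: measure_pmf_single pmf_pair)
  also have "\<dots> = pmf (bernoulli_pmf p) True" by (simp add: pmf_bernoulli_True_clamp p'_def)
  finally have p: "bernoulli_pmf p = map_pmf (\<lambda>(b, c). b \<and> c) ?J" by (intro bool_eqI) simp
  show ?thesis
  proof (rule rel_pmf.intros)
    let ?K = "map_pmf (\<lambda>(b, c). (b \<and> c, b)) ?J"
    show "map_pmf fst ?K = bernoulli_pmf p"
      unfolding p map_pmf_comp by (intro map_pmf_cong) auto
    have "map_pmf snd ?K = map_pmf fst ?J"
      unfolding map_pmf_comp by (intro map_pmf_cong) auto
    then show "map_pmf snd ?K = bernoulli_pmf q" by (simp add: q map_fst_pair_pmf)
  qed auto
qed

text \<open>Couplings of the single coordinates, drawn independently, couple the products. Outside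
  \<open>A\<close> the coupled functions take the default pair \<open>(d, e)\<close>, hence the
  assumption \<open>R d e\<close>.\<close>

lemma rel_pmf_Pi_pmf:
  assumes A: "finite A" and "R d e" and rel: "\<And>x. rel_pmf R (f x) (g x)"
  shows "rel_pmf (rel_fun (=) R) (Pi_pmf A d f) (Pi_pmf A e g)"
proof -
  have "\<forall>x. \<exists>J. (\<forall>(a, b)\<in>set_pmf J. R a b) \<and> map_pmf fst J = f x \<and> map_pmf snd J = g x"
  proof
    fix x show "\<exists>J. (\<forall>(a, b)\<in>set_pmf J. R a b) \<and> map_pmf fst J = f x \<and> map_pmf snd J = g x"
      using rel[of x] by (auto simp: pmf.in_rel)
  qed
  then obtain J where J: "\<And>x. \<forall>(a, b)\<in>set_pmf (J x). R a b"
    "\<And>x. map_pmf fst (J x) = f x" "\<And>x. map_pmf snd (J x) = g x" by metis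
  let ?P = "Pi_pmf A (d, e) J"
  have f: "Pi_pmf A d f = map_pmf (\<lambda>h. fst \<circ> h) ?P"
    unfolding J(2)[symmetric] by (rule Pi_pmf_map[OF A]) simp
  have g: "Pi_pmf A e g = map_pmf (\<lambda>h. snd \<circ> h) ?P"
    unfolding J(3)[symmetric] by (rule Pi_pmf_map[OF A]) simp
  have "R (fst (h x)) (snd (h x))" if "h \<in> set_pmf ?P" for h x
  proof -
    have "h \<in> PiE_dflt A (d, e) (set_pmf \<circ> J)" using that unfolding set_Pi_pmf[OF A] .
    then show ?thesis using J(1)[of x] \<open>R d e\<close> by (cases "x \<in> A") (auto simp: PiE_dflt_def)
  qed
  then show ?thesis
    unfolding f g pmf.rel_map by (intro rel_pmf_reflI) (auto simp: rel_fun_def)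
qed

lemma finite_ksubsets: "finite (ksubsets k N)"
  unfolding ksubsets_def by (rule finite_subset[of _ "Pow {..<N}"]) auto

lemma random_hypergraph_mono:
  assumes "\<alpha> \<le> \<beta>"
  shows "rel_pmf (\<subseteq>) (random_hypergraph k \<alpha> N) (random_hypergraph k \<beta> N)"
proof -
  have "\<alpha> * real N / real (N choose k) \<le> \<beta> * real N / real (N choose k)"
    using assms by (intro divide_right_mono mult_right_mono) auto
  then have "rel_pmf (rel_fun (=) (\<longrightarrow>))
      (Pi_pmf (ksubsets k N) False (\<lambda>_. bernoulli_pmf (\<alpha> * real N / real (N choose k))))
      (Pi_pmf (ksubsets k N) False (\<lambda>_. bernoulli_pmf (\<beta> * real N / real (N choose k))))"
    by (intro rel_pmf_Pi_pmf rel_pmf_bernoulli_mono finite_ksubsets) auto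
  then show ?thesis
    unfolding random_hypergraph_def pmf.rel_map
    by (rule pmf.rel_mono_strong) (auto simp: rel_fun_def)
qed

lemma set_random_hypergraph: "set_pmf (random_hypergraph k \<alpha> N) \<subseteq> Pow (ksubsets k N)"
  by (auto simp: random_hypergraph_def)

text \<open>In a joint distribution witnessing \<open>rel_pmf R p q\<close>, the event
  \<open>B\<close> on the second component almost surely forces \<open>A\<close> on the
  first.\<close>

lemma prob_rel_pmf_le:
  assumes "rel_pmf R p q" "\<And>x y. R x y \<Longrightarrow> x \<in> set_pmf p \<Longrightarrow> y \<in> set_pmf q \<Longrightarrow> y \<in> B \<Longrightarrow> x \<in> A"
  shows "measure_pmf.prob q B \<le> measure_pmf.prob p A"
proof -
  obtain J where J: "\<And>x y. (x, y) \<in> set_pmf J \<Longrightarrow> R x y" "map_pmf fst J = p" "map_pmf snd J = q"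
    using assms(1) by (auto elim: rel_pmf.cases)
  have "measure_pmf.prob q B = measure_pmf.prob J (snd -` B)"
    by (simp add: J(3)[symmetric])
  also have "\<dots> \<le> measure_pmf.prob J (fst -` A)"
  proof (rule measure_pmf.finite_measure_mono_AE)
    show "AE z in J. z \<in> snd -` B \<longrightarrow> z \<in> fst -` A"
      unfolding AE_measure_pmf_iff
    proof (intro ballI impI)
      fix z assume z: "z \<in> set_pmf J" "z \<in> snd -` B"
      then have "fst z \<in> set_pmf p" "snd z \<in> set_pmf q" unfolding J(2,3)[symmetric] by auto
      then show "z \<in> fst -` A" using assms(2) J(1)[of "fst z" "snd z"] z by simp
    qed
  qed simp
  also have "\<dots> = measure_pmf.prob p A" by (simp add: J(2)[symmetric])
  finally show ?thesis .
qed

section \<open>Random instances and the limit\<close>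

lemma prob_space_haar_product: "prob_space (PiM (ksubsets k N) haar_sphere)"
  by (intro prob_space_PiM prob_space_haar_sphere) (auto simp: ksubsets_def intro: finite_subset)

lemma prob_space_random_instance: "prob_space (random_instance k \<alpha> N)"
  unfolding random_instance_def
  using prob_space_haar_product measure_pmf.prob_space_axioms by (intro prob_space_pair)

text \<open>Complete stripping gives satisfiability for every choice of vectors, so the
  satisfiability event contains a rectangle whose vector side is the whole space and has mass
  1.\<close>

lemma prob_satisfiable_ge:
  "measure_pmf.prob (random_hypergraph k \<alpha> N) {E. strip\<^sup>*\<^sup>* E {}} \<le>
   \<P>(\<omega> in random_instance k \<alpha> N. satisfiable N (fst \<omega>) (snd \<omega>))"
proof -
  let ?G = "measure_pmf (random_hypergraph k \<alpha> N)" and ?P = "PiM (ksubsets k N) haar_sphere"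
  \<comment> \<open>The underlying space also contains edge sets outside
    \<open>Pow (ksubsets k N)\<close>. Cutting them off loses no probability and supplies the
    inclusion in \<open>{..<N}\<close> that the product state requires.\<close>
  let ?S = "{E \<in> Pow (ksubsets k N). strip\<^sup>*\<^sup>* E {}}"
  interpret P: prob_space ?P by (rule prob_space_haar_product)
  interpret I: prob_space "random_instance k \<alpha> N" by (rule prob_space_random_instance)
  have "measure ?G {E. strip\<^sup>*\<^sup>* E {}} = measure ?G ?S"
    by (intro measure_pmf.finite_measure_eq_AE)
      (auto simp: AE_measure_pmf_iff dest: set_random_hypergraph[THEN subsetD])
  also have "\<dots> = measure (random_instance k \<alpha> N) (?S \<times> space ?P)"
    unfolding measure_def random_instance_def
    by (simp add: P.emeasure_pair_measure_Times P.emeasure_space_1)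
  also have "\<dots> \<le> \<P>(\<omega> in random_instance k \<alpha> N. satisfiable N (fst \<omega>) (snd \<omega>))"
  proof (rule I.finite_measure_mono)
    show "?S \<times> space ?P \<subseteq> {\<omega> \<in> space (random_instance k \<alpha> N). satisfiable N (fst \<omega>) (snd \<omega>)}"
      by (auto simp: random_instance_def space_pair_measure ksubsets_def
          intro!: strip_empty_satisfiable)
    show "{\<omega> \<in> space (random_instance k \<alpha> N). satisfiable N (fst \<omega>) (snd \<omega>)} \<in> I.events"
      unfolding random_instance_def by (rule predE[OF satisfiable_measurable])
  qed
  finally show ?thesis .
qed

theorem mainTheorem5:
  fixes k :: nat and \<alpha> :: real
  assumes "k \<ge> 3"
    and "\<alpha> > 0"
    and "ereal \<alpha> < hypercore_threshold k"
  shows "(\<lambda>N. \<P>(\<omega> in random_instance k \<alpha> N. satisfiable N (fst \<omega>) (snd \<omega>))) \<longlonglongrightarrow> 1"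
proof -
  \<comment> \<open>The threshold is only a supremum, so \<open>\<alpha>\<close> need not visibly
    belong to the set defining it. A larger density \<open>\<beta>\<close> in that set is chosen,
    and the monotone coupling carries the bound down to \<open>\<alpha>\<close>.\<close>
  obtain \<beta> where \<beta>: "\<alpha> < \<beta>"
    "(\<lambda>N. measure_pmf.prob (random_hypergraph k \<beta> N) {E. hypercore E = {}}) \<longlonglongrightarrow> 1"
    using assms(3) unfolding hypercore_threshold_def less_Sup_iff by auto
  show ?thesis
  proof (rule tendsto_sandwich[OF _ _ \<beta>(2) tendsto_const])
    show "\<forall>\<^sub>F N in sequentially. measure_pmf.prob (random_hypergraph k \<beta> N) {E. hypercore E = {}}
        \<le> \<P>(\<omega> in random_instance k \<alpha> N. satisfiable N (fst \<omega>) (snd \<omega>))"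
    proof (intro always_eventually allI)
      fix N
      have "measure_pmf.prob (random_hypergraph k \<beta> N) {E. hypercore E = {}}
          \<le> measure_pmf.prob (random_hypergraph k \<alpha> N) {E. strip\<^sup>*\<^sup>* E {}}"
      proof (rule prob_rel_pmf_le[OF random_hypergraph_mono])
        fix E F assume EF: "E \<subseteq> F" "F \<in> set_pmf (random_hypergraph k \<beta> N)" "F \<in> {E. hypercore E = {}}"
        have "finite F"
          using EF(2) set_random_hypergraph finite_ksubsets by (meson PowD finite_subset subsetD)
        then show "E \<in> {E. strip\<^sup>*\<^sup>* E {}}"
          using EF by (auto simp: hypercore_eq_empty_iff intro: strip_empty_subset)
      qed (use \<beta>(1) in simp)
      also note prob_satisfiable_ge
      finally show "measure_pmf.prob (random_hypergraph k \<beta> N) {E. hypercore E = {}}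
        \<le> \<P>(\<omega> in random_instance k \<alpha> N. satisfiable N (fst \<omega>) (snd \<omega>))" .
    qed
    show "\<forall>\<^sub>F N in sequentially. \<P>(\<omega> in random_instance k \<alpha> N. satisfiable N (fst \<omega>) (snd \<omega>)) \<le> 1"
      by (intro always_eventually allI prob_space.prob_le_1 prob_space_random_instance)
  qed
qed

end
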